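(* For every integer $p\ge 2$, $$r\!\left(K_{n,n},K_{p,p},p^2-2p+2\right)=\Omega\!\left(n^{1-1/p}\right).$$
   Context: For graphs $G,H$ and an integer $q$ with $2\le q\le |E(H)|$, an $(H,q)$-coloring of $G$ is an edge-coloring of $G$ in which every subgraph of $G$ isomorphic to $H$ receives at least $q$ distinct colors; $r(G,H,q)$ is the minimum number of colors needed for $G$ to have an $(H,q)$-coloring. $K_{n,n}$, $K_{p,p}$ denote complete bipartite graphs. Asymptotic notation refers to $n\to\infty$ with $p$ fixed. *)

theory Defs
  imports Complex_Main "HOL-Library.Landau_Symbols"
begin

text \<open>An undirected graph is a pair of a vertex set and an edge set; edges are two-element
  vertex sets, so graphs satisfying \<open>simple_graph\<close> have no loops and no multiple edges.\<close>

type_synonym 'a graph = "'a set \<times> 'a set set"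

abbreviation verts :: "'a graph \<Rightarrow> 'a set" where "verts \<equiv> fst"
abbreviation edges :: "'a graph \<Rightarrow> 'a set set" where "edges \<equiv> snd"

definition simple_graph :: "'a graph \<Rightarrow> bool" where
  "simple_graph G \<longleftrightarrow> (\<forall>e \<in> edges G. e \<subseteq> verts G \<and> card e = 2)"

text \<open>Subgraphs are not required to be induced.\<close>

definition subgraph :: "'a graph \<Rightarrow> 'a graph \<Rightarrow> bool" where
  "subgraph F G \<longleftrightarrow> simple_graph F \<and> verts F \<subseteq> verts G \<and> edges F \<subseteq> edges G"

definition graph_iso :: "'a graph \<Rightarrow> 'b graph \<Rightarrow> bool" where
  "graph_iso F H \<longleftrightarrow> (\<exists>f. bij_betw f (verts F) (verts H) \<and>
     (\<forall>u \<in> verts F. \<forall>v \<in> verts F. {u, v} \<in> edges F \<longleftrightarrow> {f u, f v} \<in> edges H))"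

definition complete_bipartite :: "nat \<Rightarrow> nat \<Rightarrow> (nat + nat) graph" where
  "complete_bipartite m n =
     (Inl ` {..<m} \<union> Inr ` {..<n}, {{Inl i, Inr j} | i j. i < m \<and> j < n})"

text \<open>Edge-colorings are arbitrary (not necessarily proper). The values of \<open>c\<close> outside
  \<open>edges G\<close> are irrelevant.\<close>

definition Hq_coloring ::
  "'a graph \<Rightarrow> 'b graph \<Rightarrow> nat \<Rightarrow> ('a set \<Rightarrow> nat) \<Rightarrow> bool" where
  "Hq_coloring G H q c \<longleftrightarrow>
     (\<forall>F. subgraph F G \<and> graph_iso F H \<longrightarrow> card (c ` edges F) \<ge> q)"

text \<open>The least \<open>k\<close> such that a palette of \<open>k\<close> colors suffices. It is meant for finite \<open>G\<close>,
  finite simple \<open>H\<close> and \<open>2 \<le> q \<le> |E(H)|\<close>; then the rainbow coloring shows that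
  such a \<open>k\<close> exists (see \<open>Hq_coloring_exists\<close>).\<close>

definition gen_ramsey :: "'a graph \<Rightarrow> 'b graph \<Rightarrow> nat \<Rightarrow> nat" where
  "gen_ramsey G H q = (LEAST k. \<exists>c. c ` edges G \<subseteq> {..<k} \<and> Hq_coloring G H q c)"

lemma graph_iso_card_edges:
  assumes "simple_graph F" "simple_graph H" "graph_iso F H"
  shows "card (edges F) = card (edges H)"
proof -
  obtain f where f: "bij_betw f (verts F) (verts H)"
    and e: "\<And>u v. u \<in> verts F \<Longrightarrow> v \<in> verts F \<Longrightarrow>
              {u, v} \<in> edges F \<longleftrightarrow> {f u, f v} \<in> edges H"
    using assms(3) unfolding graph_iso_def by blast
  have inj: "inj_on ((`) f) (edges F)"
  proof (rule inj_on_subset)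
    show "inj_on ((`) f) (Pow (verts F))"
      using f by (simp add: bij_betw_def inj_on_image_Pow)
    show "edges F \<subseteq> Pow (verts F)"
      using assms(1) by (auto simp: simple_graph_def)
  qed
  have "(`) f ` edges F = edges H"
  proof (intro equalityI subsetI)
    fix x assume "x \<in> (`) f ` edges F"
    then obtain y where y: "y \<in> edges F" "x = f ` y" by auto
    moreover obtain u v where "y = {u, v}"
      using assms(1) y(1) by (auto simp: simple_graph_def card_2_iff)
    ultimately show "x \<in> edges H"
      using assms(1) e[of u v] by (auto simp: simple_graph_def)
  next
    fix x assume x: "x \<in> edges H"
    then obtain a b where ab: "x = {a, b}" "a \<in> verts H" "b \<in> verts H"
      using assms(2) by (fastforce simp: simple_graph_def card_2_iff)
    moreover obtain u v where uv: "u \<in> verts F" "v \<in> verts F" "a = f u" "b = f v"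
      using ab f unfolding bij_betw_def by (metis imageE)
    ultimately have "{u, v} \<in> edges F" "x = f ` {u, v}"
      using x e by auto
    then show "x \<in> (`) f ` edges F" by blast
  qed
  with inj show ?thesis by (metis card_image)
qed

lemma Hq_coloring_exists:
  assumes "finite (edges G)" "simple_graph H" "q \<le> card (edges H)"
  shows "\<exists>k c. c ` edges G \<subseteq> {..<k} \<and> Hq_coloring G H q c"
proof -
  obtain c where "bij_betw c (edges G) {0..<card (edges G)}"
    using ex_bij_betw_finite_nat[OF assms(1)] by blast
  then have c: "c ` edges G \<subseteq> {..<card (edges G)}" "inj_on c (edges G)"
    by (auto simp: bij_betw_def)
  have "q \<le> card (c ` edges F)" if F: "subgraph F G" "graph_iso F H" for F
  proof -
    have "inj_on c (edges F)" "simple_graph F"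
      using F(1) c(2) by (auto simp: subgraph_def intro: inj_on_subset)
    then show ?thesis
      using graph_iso_card_edges[OF _ assms(2) F(2)] assms(3) by (simp add: card_image)
  qed
  then have "Hq_coloring G H q c" by (simp add: Hq_coloring_def)
  with c(1) show ?thesis by blast
qed

lemma simple_graph_complete_bipartite: "simple_graph (complete_bipartite m n)"
  by (auto simp: simple_graph_def complete_bipartite_def)

end

theory Submission
  imports Defs
begin

text \<open>Some color class has at least \<open>n\<^sup>2 / k\<close> edges, hence a subgraph of minimum degree
  \<open>D \<approx> n / (2 k)\<close>. Grow paths of length at most \<open>p\<close> from a fixed vertex of it. As long as no two
  of them close a cycle, the number of their endpoints is multiplied by at least \<open>D - p\<close> in each
  step, so \<open>(D - p)\<^sup>p \<le> n\<close>, which is the claimed bound. Otherwise two such paths span a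
  connected graph containing a cycle with at most \<open>p\<close> vertices on each side; attaching further
  vertices yields a copy of \<open>K\<^sub>p\<^sub>,\<^sub>p\<close> with \<open>2 p\<close> edges of the same color, so at most
  \<open>p\<^sup>2 - 2 p + 1\<close> colors.\<close>

section \<open>Edge counts in bipartite graphs\<close>

definition induced_edges :: "'a set set \<Rightarrow> 'a set \<Rightarrow> 'a set set" where
  "induced_edges E S = {e \<in> E. e \<subseteq> S}"

definition nbrs :: "'a set set \<Rightarrow> 'a set \<Rightarrow> 'a \<Rightarrow> 'a set" where
  "nbrs E S u = {w \<in> S. {u, w} \<in> E}"

lemma finite_induced_edges: "finite S \<Longrightarrow> finite (induced_edges E S)"
  by (rule finite_subset[of _ "Pow S"]) (auto simp: induced_edges_def)

lemma finite_nbrs: "finite S \<Longrightarrow> finite (nbrs E S u)"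
  by (simp add: nbrs_def)

text \<open>The edges joining \<open>w\<close> to \<open>N\<close> are distinct, and none lies
  inside \<open>S\<close> because \<open>w\<close> does not. With one neighbor this pays for an
  attached vertex; with two neighbors it gains the extra edge that closes a cycle.\<close>

lemma card_induced_edges_insert:
  assumes "finite S" "w \<notin> S" "N \<subseteq> nbrs E S w"
  shows "card (induced_edges E S) + card N \<le> card (induced_edges E (insert w S))"
proof -
  have N: "finite N" "N \<subseteq> S"
    using assms by (auto simp: nbrs_def intro: finite_subset)
  have "inj_on (\<lambda>u. {w, u}) N"
    by (auto simp: inj_on_def doubleton_eq_iff)
  then have "card (induced_edges E S) + card N
      = card (induced_edges E S) + card ((\<lambda>u. {w, u}) ` N)"
    by (simp add: card_image)
  also have "\<dots> = card (induced_edges E S \<union> (\<lambda>u. {w, u}) ` N)"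
    using assms N by (intro card_Un_disjoint[symmetric] finite_induced_edges)
      (auto simp: induced_edges_def)
  also have "\<dots> \<le> card (induced_edges E (insert w S))"
    using assms by (intro card_mono finite_induced_edges) (auto simp: induced_edges_def nbrs_def)
  finally show ?thesis .
qed

text \<open>Any set \<open>A\<close> that splits every edge is allowed, so passing to
  \<open>- A\<close> exchanges the two sides and a one-sided argument serves for both.\<close>

locale bipartite_edges =
  fixes E :: "'a set set" and A :: "'a set"
  assumes edgeE: "e \<in> E \<Longrightarrow> \<exists>x y. e = {x, y} \<and> x \<in> A \<and> y \<notin> A"
begin

lemma bipartite_edges_Compl: "bipartite_edges E (- A)"
proof
  fix e assume "e \<in> E"
  then obtain x y where "e = {y, x}" "x \<in> A" "y \<notin> A"
    using edgeE by (metis insert_commute)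
  then show "\<exists>x y. e = {x, y} \<and> x \<in> - A \<and> y \<notin> - A"
    by auto
qed

lemma edge_sides: "{u, w} \<in> E \<Longrightarrow> w \<in> A \<longleftrightarrow> u \<notin> A"
  using edgeE[of "{u, w}"] by (auto simp: doubleton_eq_iff)

lemma empty_not_edge: "{} \<notin> E"
  using edgeE[of "{}"] by auto

lemma card_induced_edges_remove:
  assumes "finite U"
  shows "card (induced_edges E U) \<le> card (induced_edges E (U - {u})) + card (nbrs E U u)"
proof -
  have "induced_edges E U \<subseteq> induced_edges E (U - {u}) \<union> (\<lambda>w. {u, w}) ` nbrs E U u"
  proof
    fix e assume e: "e \<in> induced_edges E U"
    then obtain x y where xy: "e = {x, y}"
      using edgeE[of e] by (auto simp: induced_edges_def)
    with e show "e \<in> induced_edges E (U - {u}) \<union> (\<lambda>w. {u, w}) ` nbrs E U u"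
      by (auto simp: induced_edges_def nbrs_def insert_commute)
  qed
  then have "card (induced_edges E U)
      \<le> card (induced_edges E (U - {u}) \<union> (\<lambda>w. {u, w}) ` nbrs E U u)"
    using assms by (intro card_mono) (auto simp: finite_induced_edges finite_nbrs)
  also have "\<dots> \<le> card (induced_edges E (U - {u})) + card ((\<lambda>w. {u, w}) ` nbrs E U u)"
    by (rule card_Un_le)
  also have "\<dots> \<le> card (induced_edges E (U - {u})) + card (nbrs E U u)"
    using assms by (simp add: card_image_le finite_nbrs)
  finally show ?thesis .
qed

text \<open>Deleting a vertex of degree below \<open>D\<close> costs fewer than \<open>D\<close>
  edges, while \<open>D * card V\<close> drops by exactly \<open>D\<close>. The density hypothesis
  therefore survives the deletion, and the process must stop.\<close>

lemma min_degree_subgraph: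
  assumes "finite V" "V \<noteq> {}" "D * card V \<le> card (induced_edges E V)"
  shows "\<exists>U \<subseteq> V. U \<noteq> {} \<and> (\<forall>u\<in>U. D \<le> card (nbrs E U u))"
  using assms
proof (induction V rule: finite_psubset_induct)
  case (psubset V)
  show ?case
  proof (cases "\<forall>u\<in>V. D \<le> card (nbrs E V u)")
    case True
    with psubset show ?thesis by blast
  next
    case False
    then obtain u where u: "u \<in> V" "card (nbrs E V u) < D"
      by (auto simp: not_le)
    have "card V = Suc (card (V - {u}))"
      using u(1) psubset.hyps(1) by (simp only: card_Suc_Diff1)
    then have "D * card V = D * card (V - {u}) + D"
      by (metis mult_Suc_right add.commute)
    then have *: "D * card (V - {u}) < card (induced_edges E (V - {u}))"
      using card_induced_edges_remove[OF psubset.hyps(1), of u] u psubset.prems(2) by linarith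
    \<comment> \<open>The strict inequality just obtained leaves at least one edge, so the deletions
      never exhaust the graph.\<close>
    have "V - {u} \<noteq> {}"
    proof
      assume "V - {u} = {}"
      then have "induced_edges E (V - {u}) = {}"
        using empty_not_edge unfolding induced_edges_def by (metis (mono_tags, lifting)
            Collect_empty_eq subset_empty)
      with * show False by simp
    qed
    moreover have "V - {u} \<subset> V"
      using u(1) by blast
    ultimately have "\<exists>U \<subseteq> V - {u}. U \<noteq> {} \<and> (\<forall>u\<in>U. D \<le> card (nbrs E U u))"
      using psubset.IH[of "V - {u}"] * by simp
    then show ?thesis by blast
  qed
qed

section \<open>Enlarging a set to prescribed side sizes\<close>

text \<open>Since \<open>S\<close> spans an edge, it has a vertex \<open>u\<close> outside
  \<open>A\<close>. All neighbors of \<open>u\<close> lie in \<open>A\<close>, and fewer than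
  \<open>p\<close> of them are in \<open>S\<close> as long as that side is not full. Attaching a new
  one adds one vertex and at least one edge.\<close>

lemma extend_side:
  assumes "finite U" and deg: "\<And>u. u \<in> U \<Longrightarrow> p \<le> card (nbrs E U u)"
    and "S \<subseteq> U" "S \<noteq> {}" "card (S \<inter> A) \<le> p" "card S \<le> card (induced_edges E S)"
  shows "\<exists>S' \<subseteq> U. S \<subseteq> S' \<and> card (S' \<inter> A) = p \<and> S' - A = S - A
    \<and> card S' \<le> card (induced_edges E S')"
  using assms(3-)
proof (induction "p - card (S \<inter> A)" arbitrary: S)
  case 0
  then show ?case by auto
next
  case (Suc k)
  have "finite S"
    using Suc.prems assms(1) finite_subset by blast
  then have "induced_edges E S \<noteq> {}"
    using Suc.prems by auto
  then obtain e where "e \<in> E" "e \<subseteq> S"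
    by (auto simp: induced_edges_def)
  then obtain u where u: "u \<in> S" "u \<notin> A"
    using edgeE[of e] by blast
  have "\<not> nbrs E U u \<subseteq> S \<inter> A"
  proof
    assume "nbrs E U u \<subseteq> S \<inter> A"
    then have "card (nbrs E U u) \<le> card (S \<inter> A)"
      using \<open>finite S\<close> by (simp add: card_mono)
    then show False
      using deg[of u] u Suc by auto
  qed
  then obtain w where w: "w \<in> U" "{u, w} \<in> E" "w \<in> A" "w \<notin> S"
    using edge_sides u by (fastforce simp: nbrs_def)
  have "card (induced_edges E S) + card {u} \<le> card (induced_edges E (insert w S))"
    using w u \<open>finite S\<close> by (intro card_induced_edges_insert) (auto simp: nbrs_def insert_commute)
  then have "card (insert w S) \<le> card (induced_edges E (insert w S))"
    using Suc.prems w \<open>finite S\<close> by simp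
  moreover have "card (insert w S \<inter> A) = Suc (card (S \<inter> A))"
    using w \<open>finite S\<close> by simp
  ultimately have "\<exists>S' \<subseteq> U. insert w S \<subseteq> S' \<and> card (S' \<inter> A) = p \<and> S' - A = insert w S - A
    \<and> card S' \<le> card (induced_edges E S')"
    using Suc.hyps(2) Suc.prems(1) w by (intro Suc.hyps(1)) auto
  moreover have "insert w S - A = S - A"
    using w by blast
  ultimately show ?case
    by auto
qed

text \<open>Fill the side \<open>A\<close> first, then apply the same argument to
  \<open>- A\<close>, which leaves the filled side alone. The final set has \<open>2 * p\<close>
  vertices, hence at least as many edges.\<close>

lemma extend_balanced:
  assumes "finite U" and deg: "\<And>u. u \<in> U \<Longrightarrow> p \<le> card (nbrs E U u)"
    and "S \<subseteq> U" "S \<noteq> {}" "card (S \<inter> A) \<le> p" "card (S - A) \<le> p"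
    and "card S \<le> card (induced_edges E S)"
  shows "\<exists>S' \<subseteq> U. card (S' \<inter> A) = p \<and> card (S' - A) = p \<and> 2 * p \<le> card (induced_edges E S')"
proof -
  interpret co: bipartite_edges E "- A"
    by (rule bipartite_edges_Compl)
  obtain S1 where S1: "S1 \<subseteq> U" "S \<subseteq> S1" "card (S1 \<inter> A) = p" "S1 - A = S - A"
    "card S1 \<le> card (induced_edges E S1)"
    using extend_side[of U p S] assms by blast
  have "S1 \<noteq> {}"
    using S1 assms by blast
  moreover have "card (S1 \<inter> - A) \<le> p"
    using S1 assms by (simp add: Diff_eq)
  ultimately obtain S2 where S2: "S2 \<subseteq> U" "card (S2 \<inter> - A) = p" "S2 - - A = S1 - - A"
    "card S2 \<le> card (induced_edges E S2)"
    using co.extend_side[of U p S1] assms(1,2) S1 by blast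
  have "S2 \<inter> A = S1 \<inter> A"
    using S2 by blast
  moreover have "card S2 = card (S2 \<inter> A) + card (S2 - A)"
    using S2 assms(1) by (metis card_Int_Diff rev_finite_subset)
  ultimately show ?thesis
    using S1 S2 by (intro exI[of _ S2]) (auto simp: Diff_eq)
qed

section \<open>Growing paths and a Moore-type bound\<close>

text \<open>The set \<open>T u\<close> consists of the vertices of a path of length \<open>i\<close> from \<open>v\<close> to \<open>u\<close>, and the
  inequality for \<open>T u \<union> T u'\<close> replaces the connectedness of the union of two such paths.\<close>

definition path_family :: "'a set \<Rightarrow> 'a \<Rightarrow> nat \<Rightarrow> 'a set \<Rightarrow> ('a \<Rightarrow> 'a set) \<Rightarrow> bool" where
  "path_family U v i L T \<longleftrightarrow> L \<subseteq> U \<and> (\<forall>u\<in>L. u \<in> A \<longleftrightarrow> even i)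
    \<and> (\<forall>u\<in>L. u \<in> T u \<and> v \<in> T u \<and> T u \<subseteq> U
         \<and> card (T u \<inter> A) \<le> i div 2 + 1 \<and> card (T u - A) \<le> (i + 1) div 2)
    \<and> (\<forall>u\<in>L. \<forall>u'\<in>L. card (T u \<union> T u') \<le> card (induced_edges E (T u \<union> T u')) + 1)"

text \<open>Each path extends to at least \<open>D - p\<close> vertices outside itself, and paths to
  distinct endpoints have disjoint sets of extensions: a common one would close a cycle in a set
  small enough for \<open>sparse\<close>.\<close>

lemma path_endpoints_grow:
  assumes "finite U" and deg: "\<And>u. u \<in> U \<Longrightarrow> D \<le> card (nbrs E U u)"
    and sparse: "\<And>S. S \<subseteq> U \<Longrightarrow> S \<noteq> {} \<Longrightarrow> card (S \<inter> A) \<le> p \<Longrightarrow> card (S - A) \<le> p \<Longrightarrow>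
      card (induced_edges E S) < card S"
    and v: "v \<in> U" "v \<in> A" and "i \<le> p"
  shows "\<exists>L T. path_family U v i L T \<and> (D - p) ^ i \<le> card L"
  using \<open>i \<le> p\<close>
proof (induction i)
  case 0
  show ?case
    using v by (intro exI[of _ "{v}"] exI[of _ "\<lambda>_. {v}"]) (auto simp: path_family_def)
next
  case (Suc i)
  then obtain L T where LT: "path_family U v i L T" and card_L: "(D - p) ^ i \<le> card L"
    by auto
  from LT have L: "L \<subseteq> U" "\<And>u. u \<in> L \<Longrightarrow> u \<in> A \<longleftrightarrow> even i"
    and T: "\<And>u. u \<in> L \<Longrightarrow> u \<in> T u" "\<And>u. u \<in> L \<Longrightarrow> v \<in> T u" "\<And>u. u \<in> L \<Longrightarrow> T u \<subseteq> U"
      "\<And>u. u \<in> L \<Longrightarrow> card (T u \<inter> A) \<le> i div 2 + 1"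
      "\<And>u. u \<in> L \<Longrightarrow> card (T u - A) \<le> (i + 1) div 2"
    and conn: "\<And>u u'. u \<in> L \<Longrightarrow> u' \<in> L \<Longrightarrow>
      card (T u \<union> T u') \<le> card (induced_edges E (T u \<union> T u')) + 1"
    by (simp_all add: path_family_def)
  have finT: "finite (T u)" if "u \<in> L" for u
    using T(3)[OF that] assms(1) by (rule finite_subset)
  define C where "C u = nbrs E U u - T u" for u
  have C: "w \<in> U" "{u, w} \<in> E" "w \<notin> T u" if "w \<in> C u" for u w
    using that by (auto simp: C_def nbrs_def)
  have C_side: "w \<in> A \<longleftrightarrow> odd i" if "w \<in> C u" "u \<in> L" for u w
    using edge_sides[OF C(2)[OF that(1)]] L(2)[OF that(2)] by simp
  have finC: "finite (C u)" for u
    using assms(1) by (simp add: C_def finite_nbrs)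
  have card_C: "D - p \<le> card (C u)" if u: "u \<in> L" for u
  proof -
    have "card (T u) = card (T u \<inter> A) + card (T u - A)"
      using finT[OF u] by (metis card_Int_Diff)
    then have "card (T u) \<le> i div 2 + 1 + (i + 1) div 2"
      using T(4,5)[OF u] by linarith
    \<comment> \<open>The two halves add up to \<open>i + 1\<close>, the number of vertices on a
      path of length \<open>i\<close>.\<close>
    then have "card (T u) \<le> p"
      using Suc.prems by linarith
    moreover have "card (nbrs E U u) - card (T u) \<le> card (C u)"
      unfolding C_def by (rule diff_card_le_card_Diff[OF finT[OF u]])
    moreover have "D \<le> card (nbrs E U u)"
      using deg u L(1) by blast
    ultimately show ?thesis
      by linarith
  qed
  have disj: "C u \<inter> C u' = {}" if u: "u \<in> L" "u' \<in> L" "u \<noteq> u'" for u u'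
  proof (rule ccontr)
    assume "C u \<inter> C u' \<noteq> {}"
    then obtain w where w: "w \<in> C u" "w \<in> C u'"
      by blast
    define S where "S = T u \<union> T u'"
    have S: "finite S" "S \<subseteq> U" "w \<notin> S" "card S \<le> card (induced_edges E S) + 1"
      using finT u T(3) C(3) w conn by (auto simp: S_def)
    \<comment> \<open>The vertex \<open>w\<close> brings two edges, one to each endpoint; the second
      cancels the \<open>+ 1\<close> in the inequality for \<open>S\<close>.\<close>
    have "card (induced_edges E S) + card {u, u'} \<le> card (induced_edges E (insert w S))"
      using S T(1) u C(2)[OF w(1)] C(2)[OF w(2)]
      by (intro card_induced_edges_insert) (auto simp: nbrs_def insert_commute S_def)
    then have excess: "card (insert w S) \<le> card (induced_edges E (insert w S))"
      using S u by simp
    \<comment> \<open>Both paths contain \<open>v\<close>, which lies in \<open>A\<close>, so the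
      union has one vertex fewer on that side than the sum. Without this saving the bound
      \<open>p\<close> would be missed by one.\<close>
    have "card (S \<inter> A) + card ((T u \<inter> A) \<inter> (T u' \<inter> A)) = card (T u \<inter> A) + card (T u' \<inter> A)"
      using finT u card_Un_Int[of "T u \<inter> A" "T u' \<inter> A"] by (simp add: S_def Int_Un_distrib2)
    moreover have "0 < card ((T u \<inter> A) \<inter> (T u' \<inter> A))"
      using finT T(2)[OF u(1)] T(2)[OF u(2)] u v by (auto simp: card_gt_0_iff)
    ultimately have SA: "card (S \<inter> A) \<le> 2 * (i div 2) + 1"
      using T(4)[OF u(1)] T(4)[OF u(2)] by linarith
    have "S - A = (T u - A) \<union> (T u' - A)"
      by (auto simp: S_def)
    then have SB: "card (S - A) \<le> 2 * ((i + 1) div 2)"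
      using card_Un_le[of "T u - A" "T u' - A"] T(5)[OF u(1)] T(5)[OF u(2)] by simp
    \<comment> \<open>For either parity of \<open>i\<close>, both sides end up with at most
      \<open>i + 1\<close> vertices.\<close>
    have "card (insert w S \<inter> A) \<le> p \<and> card (insert w S - A) \<le> p"
    proof (cases "even i")
      case True
      then have "w \<notin> A"
        using C_side w u by blast
      then have "card (insert w S \<inter> A) = card (S \<inter> A)" "card (insert w S - A) = Suc (card (S - A))"
        using S by (auto simp: insert_Diff_if)
      with True SA SB Suc.prems show ?thesis
        by auto
    next
      case False
      then have "w \<in> A"
        using C_side w u by blast
      then have "card (insert w S \<inter> A) = Suc (card (S \<inter> A))" "card (insert w S - A) = card (S - A)"
        using S by (auto simp: insert_Diff_if)
      with False SA SB Suc.prems show ?thesis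
        by (auto elim!: oddE)
    qed
    then have "card (induced_edges E (insert w S)) < card (insert w S)"
      using S C(1)[OF w(1)] by (intro sparse) auto
    with excess show False
      by simp
  qed
  define L' where "L' = (\<Union>u\<in>L. C u)"
  have finL: "finite L"
    using L(1) assms(1) by (rule finite_subset)
  have "(D - p) ^ Suc i \<le> card L * (D - p)"
    using card_L by (simp add: mult.commute)
  also have "\<dots> \<le> (\<Sum>u\<in>L. card (C u))"
    using sum_bounded_below[of L "D - p" "\<lambda>u. card (C u)"] card_C by simp
  also have "\<dots> = card L'"
    unfolding L'_def using finL finC disj by (intro card_UN_disjoint[symmetric]) auto
  finally have card_L': "(D - p) ^ Suc i \<le> card L'" .
  have "\<forall>w\<in>L'. \<exists>u. u \<in> L \<and> w \<in> C u"
    by (auto simp: L'_def)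
  then obtain par where par: "\<And>w. w \<in> L' \<Longrightarrow> par w \<in> L" "\<And>w. w \<in> L' \<Longrightarrow> w \<in> C (par w)"
    by metis
  define T' where "T' w = insert w (T (par w))" for w
  \<comment> \<open>Attaching a vertex with a neighbor in \<open>S\<close> preserves the inequality.
    The vertex may already be in \<open>S\<close>, as happens below when \<open>w = w'\<close> or
    when one path runs through the other endpoint.\<close>
  have step: "card (insert w S) \<le> card (induced_edges E (insert w S)) + 1"
    if "finite S" "card S \<le> card (induced_edges E S) + 1" "u \<in> S" "{u, w} \<in> E" for S u w
  proof (cases "w \<in> S")
    case True
    with that show ?thesis by (simp add: insert_absorb)
  next
    case False
    have "card (induced_edges E S) + card {u} \<le> card (induced_edges E (insert w S))"
      using that False
      by (intro card_induced_edges_insert) (auto simp: nbrs_def insert_commute)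
    with that False show ?thesis by simp
  qed
  have "path_family U v (Suc i) L' T'"
    unfolding path_family_def
  proof (intro conjI ballI)
    show "L' \<subseteq> U"
      using C by (auto simp: L'_def)
  next
    fix w assume w: "w \<in> L'"
    note p = par[OF w]
    show side: "w \<in> A \<longleftrightarrow> even (Suc i)"
      using C_side[OF p(2,1)] by simp
    show "w \<in> T' w" "v \<in> T' w" "T' w \<subseteq> U"
      using T(2,3)[OF p(1)] C(1)[OF p(2)] by (auto simp: T'_def)
    have "card (T' w \<inter> A) \<le> (if even i then card (T (par w) \<inter> A) else Suc (card (T (par w) \<inter> A)))"
      using side finT[OF p(1)] by (auto simp: T'_def card_insert_if)
    then show "card (T' w \<inter> A) \<le> Suc i div 2 + 1"
      using T(4)[OF p(1)] by (auto split: if_splits elim!: oddE)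
    have "card (T' w - A) \<le> (if even i then Suc (card (T (par w) - A)) else card (T (par w) - A))"
      using side finT[OF p(1)] by (auto simp: T'_def card_insert_if insert_Diff_if)
    then show "card (T' w - A) \<le> (Suc i + 1) div 2"
      using T(5)[OF p(1)] by (auto split: if_splits elim!: evenE)
  next
    fix w w' assume w: "w \<in> L'" "w' \<in> L'"
    define S where "S = T (par w) \<union> T (par w')"
    have "card (insert w S) \<le> card (induced_edges E (insert w S)) + 1"
      using w par T(1) finT conn C(2) by (intro step[of _ "par w"]) (auto simp: S_def)
    then have "card (insert w' (insert w S)) \<le> card (induced_edges E (insert w' (insert w S))) + 1"
      using w par T(1) finT C(2) by (intro step[of "insert w S" "par w'"]) (simp_all add: S_def)
    moreover have "insert w' (insert w S) = T' w \<union> T' w'"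
      by (auto simp: S_def T'_def)
    ultimately show "card (T' w \<union> T' w') \<le> card (induced_edges E (T' w \<union> T' w')) + 1"
      by simp
  qed
  with card_L' show ?case
    by blast
qed

text \<open>By parity the endpoints of all paths of length \<open>p\<close> lie on a single side,
  which has at most \<open>n\<close> vertices.\<close>

lemma moore_bound:
  assumes "finite U" and deg: "\<And>u. u \<in> U \<Longrightarrow> D \<le> card (nbrs E U u)"
    and sparse: "\<And>S. S \<subseteq> U \<Longrightarrow> S \<noteq> {} \<Longrightarrow> card (S \<inter> A) \<le> p \<Longrightarrow> card (S - A) \<le> p \<Longrightarrow>
      card (induced_edges E S) < card S"
    and "v \<in> U" "v \<in> A" and n: "card (U \<inter> A) \<le> n" "card (U - A) \<le> n"
  shows "(D - p) ^ p \<le> n"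
proof -
  obtain L T where "path_family U v p L T" and card_L: "(D - p) ^ p \<le> card L"
    using path_endpoints_grow[OF assms(1-5) order.refl] by blast
  then have L: "L \<subseteq> U" "\<And>u. u \<in> L \<Longrightarrow> u \<in> A \<longleftrightarrow> even p"
    by (simp_all add: path_family_def)
  have "card L \<le> n"
  proof (cases "even p")
    case True
    then have "card L \<le> card (U \<inter> A)"
      using L assms(1) by (intro card_mono) auto
    with n show ?thesis by simp
  next
    case False
    then have "card L \<le> card (U - A)"
      using L assms(1) by (intro card_mono) auto
    with n show ?thesis by simp
  qed
  with card_L show ?thesis by simp
qed

text \<open>In a subgraph of minimum degree \<open>D\<close>, the Moore-type bound fails, so some
  small set spans at least as many edges as it has vertices; this set is then enlarged to
  \<open>p\<close> vertices on each side.\<close>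

lemma dense_balanced_subgraph:
  assumes "finite V" "V \<noteq> {}" "D * card V \<le> card (induced_edges E V)"
    and n: "card (V \<inter> A) \<le> n" "card (V - A) \<le> n" and "n < (D - p) ^ p" "p > 0"
  shows "\<exists>S \<subseteq> V. card (S \<inter> A) = p \<and> card (S - A) = p \<and> 2 * p \<le> card (induced_edges E S)"
proof -
  obtain U where U: "U \<subseteq> V" "U \<noteq> {}" "\<And>u. u \<in> U \<Longrightarrow> D \<le> card (nbrs E U u)"
    using min_degree_subgraph[OF assms(1-3)] by blast
  have fin: "finite U"
    using U(1) assms(1) by (rule finite_subset)
  have "card (U \<inter> A) \<le> card (V \<inter> A)" "card (U - A) \<le> card (V - A)"
    using U(1) assms(1) by (auto intro!: card_mono)
  then have nU: "card (U \<inter> A) \<le> n" "card (U - A) \<le> n"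
    using n by auto
  \<comment> \<open>Otherwise the truncated difference \<open>D - p\<close> is \<open>0\<close>, and
    so is its power because \<open>p > 0\<close>.\<close>
  have "p \<le> D"
    using assms(6,7) by (cases "p \<le> D") (auto simp: power_0_left)
  interpret co: bipartite_edges E "- A"
    by (rule bipartite_edges_Compl)
  have "\<exists>S. S \<subseteq> U \<and> S \<noteq> {} \<and> card (S \<inter> A) \<le> p \<and> card (S - A) \<le> p
      \<and> card S \<le> card (induced_edges E S)"
  proof (rule ccontr)
    assume "\<not> ?thesis"
    then have sparse: "card (induced_edges E S) < card S"
      if "S \<subseteq> U" "S \<noteq> {}" "card (S \<inter> A) \<le> p" "card (S - A) \<le> p" for S
      using that by (meson not_le)
    obtain v where v: "v \<in> U"
      using U(2) by blast
    have "(D - p) ^ p \<le> n"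
    \<comment> \<open>The start vertex may fall on either side; outside \<open>A\<close> the roles
      of the sides are exchanged.\<close>
    proof (cases "v \<in> A")
      case True
      then show ?thesis
        using moore_bound[OF fin U(3) sparse v] nU by blast
    next
      case False
      have "card (induced_edges E S) < card S"
        if "S \<subseteq> U" "S \<noteq> {}" "card (S \<inter> - A) \<le> p" "card (S - - A) \<le> p" for S
        using that by (intro sparse) (simp_all add: Diff_eq)
      with False show ?thesis
        using nU by (intro co.moore_bound[OF fin U(3) _ v]) (simp_all add: Diff_eq)
    qed
    with assms(6) show False by simp
  qed
  then obtain S where "S \<subseteq> U" "S \<noteq> {}" "card (S \<inter> A) \<le> p" "card (S - A) \<le> p"
    "card S \<le> card (induced_edges E S)"
    by blast
  then obtain S' where "S' \<subseteq> U" "card (S' \<inter> A) = p" "card (S' - A) = p"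
    "2 * p \<le> card (induced_edges E S')"
    using extend_balanced[OF fin, of p S] U(3) \<open>p \<le> D\<close> by (meson order.trans)
  then show ?thesis
    using U(1) by blast
qed

end

section \<open>Copies of the complete bipartite graph\<close>

lemma card_edges_complete_bipartite: "card (edges (complete_bipartite m n)) = m * n"
proof -
  have "edges (complete_bipartite m n) = (\<lambda>(i, j). {Inl i, Inr j}) ` ({..<m} \<times> {..<n})"
    by (auto simp: complete_bipartite_def)
  moreover have "inj_on (\<lambda>(i, j). {Inl i, Inr j}) ({..<m} \<times> {..<n})"
    by (auto simp: inj_on_def doubleton_eq_iff)
  ultimately show ?thesis
    by (simp add: card_image card_cartesian_product)
qed

text \<open>A bijection that respects the two sides is an isomorphism, since adjacency means lying
  on different sides.\<close>

lemma induced_complete_bipartite_iso: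
  assumes S: "S \<subseteq> verts (complete_bipartite n n)"
    and card: "card (S \<inter> range Inl) = p" "card (S - range Inl) = p"
  shows "graph_iso (S, induced_edges (edges (complete_bipartite n n)) S) (complete_bipartite p p)"
proof -
  have fin: "finite S"
    using S by (rule finite_subset) (simp add: complete_bipartite_def)
  obtain f g where f: "bij_betw f (S \<inter> range Inl) {..<p}" and g: "bij_betw g (S - range Inl) {..<p}"
    using fin card by (metis ex_bij_betw_finite_nat atLeast0LessThan finite_Diff finite_Int)
  define h where "h x = (if x \<in> range Inl then Inl (f x) else Inr (g x))" for x :: "nat + nat"
  have "bij_betw (\<lambda>x. Inl (f x) :: nat + nat) (S \<inter> range Inl) (Inl ` {..<p})"
    using bij_betw_trans[OF f bij_betw_imageI[of Inl]] by (simp add: comp_def)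
  then have 1: "bij_betw h (S \<inter> range Inl) (Inl ` {..<p})"
    by (rule bij_betw_cong[THEN iffD1, rotated]) (auto simp: h_def)
  have "bij_betw (\<lambda>x. Inr (g x) :: nat + nat) (S - range Inl) (Inr ` {..<p})"
    using bij_betw_trans[OF g bij_betw_imageI[of Inr]] by (simp add: comp_def)
  then have 2: "bij_betw h (S - range Inl) (Inr ` {..<p})"
    by (rule bij_betw_cong[THEN iffD1, rotated]) (auto simp: h_def)
  have "bij_betw h ((S \<inter> range Inl) \<union> (S - range Inl)) (Inl ` {..<p} \<union> Inr ` {..<p})"
    by (rule bij_betw_combine[OF 1 2]) auto
  then have bij: "bij_betw h S (verts (complete_bipartite p p))"
    by (simp add: complete_bipartite_def Int_Diff_Un)
  have adj: "{x, y} \<in> edges (complete_bipartite m m) \<longleftrightarrow> (x \<in> range Inl \<longleftrightarrow> y \<notin> range Inl)"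
    if "x \<in> verts (complete_bipartite m m)" "y \<in> verts (complete_bipartite m m)" for m x y
    using that by (auto simp: complete_bipartite_def doubleton_eq_iff)
  have "{x, y} \<in> induced_edges (edges (complete_bipartite n n)) S
      \<longleftrightarrow> {h x, h y} \<in> edges (complete_bipartite p p)" if xy: "x \<in> S" "y \<in> S" for x y
  proof -
    have "h x \<in> verts (complete_bipartite p p)" "h y \<in> verts (complete_bipartite p p)"
      using bij xy by (auto dest: bij_betwE)
    then have "{h x, h y} \<in> edges (complete_bipartite p p)
        \<longleftrightarrow> (h x \<in> range Inl \<longleftrightarrow> h y \<notin> range Inl)"
      by (rule adj)
    also have "\<dots> \<longleftrightarrow> (x \<in> range Inl \<longleftrightarrow> y \<notin> range Inl)"
      by (auto simp: h_def)
    also have "\<dots> \<longleftrightarrow> {x, y} \<in> edges (complete_bipartite n n)"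
      using adj[of x n y] S xy by blast
    finally show ?thesis
      using xy by (simp add: induced_edges_def)
  qed
  with bij show ?thesis
    unfolding graph_iso_def by auto
qed

section \<open>A dense color class forces a copy with few colors\<close>

lemma Hq_coloring_color_bound:
  assumes c: "c ` edges (complete_bipartite n n) \<subseteq> {..<k}"
    and col: "Hq_coloring (complete_bipartite n n) (complete_bipartite p p) (p^2 - 2*p + 2) c"
    and "p \<ge> 2" "n > 0"
  shows "(n div (2 * k) - p) ^ p \<le> n"
proof (rule ccontr)
  assume "\<not> ?thesis"
  then have big: "n < (n div (2 * k) - p) ^ p"
    by simp
  \<comment> \<open>A largest color class has at least \<open>n * n / k\<close> edges on
    \<open>2 * n\<close> vertices, which is \<open>n / (2 * k)\<close> edges per vertex;
    \<open>D\<close> rounds this down.\<close>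
  define D where "D = n div (2 * k)"
  define K where "K = edges (complete_bipartite n n)"
  define V where "V = verts (complete_bipartite n n)"
  have K: "card K = n * n"
    by (simp add: K_def card_edges_complete_bipartite)
  have VK: "e \<subseteq> V" if "e \<in> K" for e
    using that by (auto simp: K_def V_def complete_bipartite_def)
  have finK: "finite K"
    using K \<open>n > 0\<close> by (metis card_gt_0_iff nat_0_less_mult_iff)
  have VL: "V \<inter> range Inl = Inl ` {..<n}" and VR: "V - range Inl = Inr ` {..<n}"
    by (auto simp: V_def complete_bipartite_def)
  have finV: "finite V" and V0: "V \<noteq> {}"
    using \<open>n > 0\<close> by (auto simp: V_def complete_bipartite_def)
  have sides: "card (V \<inter> range Inl) = n" "card (V - range Inl) = n"
    unfolding VL VR by (simp_all add: card_image)
  then have cardV: "card V = 2 * n"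
    using card_Int_Diff[OF finV, of "range Inl"] by simp
  obtain a where a: "card K \<le> k * card {e \<in> K. c e = a}"
  proof -
    have "card K \<le> (\<Sum>a<k. card {e \<in> K. c e = a})"
    proof -
      have "K = (\<Union>a<k. {e \<in> K. c e = a})"
        using c by (auto simp: K_def)
      then show ?thesis
        using card_UN_le[of "{..<k}" "\<lambda>a. {e \<in> K. c e = a}"] by simp
    qed
    \<comment> \<open>Averaging: if every class were smaller than the mean, summing over all
      \<open>k\<close> colors would give a sum strictly below itself.\<close>
    moreover have "\<exists>a. (\<Sum>a<k. card {e \<in> K. c e = a}) \<le> k * card {e \<in> K. c e = a}"
    proof (rule ccontr)
      assume neg: "\<not> ?thesis"
      have "k > 0"
        using neg by (cases k) auto
      have "k * (\<Sum>a<k. card {e \<in> K. c e = a}) = (\<Sum>a<k. k * card {e \<in> K. c e = a})"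
        by (simp add: sum_distrib_left)
      also have "\<dots> < (\<Sum>b<k. \<Sum>a<k. card {e \<in> K. c e = a})"
        using neg \<open>k > 0\<close> by (intro sum_strict_mono) (auto simp: not_le)
      finally show False by simp
    qed
    ultimately show ?thesis
      using that order.trans by blast
  qed
  define E where "E = {e \<in> K. c e = a}"
  interpret bipartite_edges E "range Inl"
    by standard (auto simp: E_def K_def complete_bipartite_def)
  have EV: "induced_edges E V = E"
    using VK by (auto simp: induced_edges_def E_def)
  have "k > 0"
    using a K \<open>n > 0\<close> by (cases k) auto
  have "D * card V \<le> card (induced_edges E V)"
  proof -
    have "k * (D * card V) = (D * (2 * k)) * n"
      by (simp add: cardV)
    also have "\<dots> \<le> n * n"
      unfolding D_def by (intro mult_le_mono1 div_times_less_eq_dividend)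
    also have "\<dots> \<le> k * card E"
      using a K by (simp add: E_def)
    finally show ?thesis
      using \<open>k > 0\<close> by (simp add: EV)
  qed
  then obtain S where S: "S \<subseteq> V" "card (S \<inter> range Inl) = p" "card (S - range Inl) = p"
    "2 * p \<le> card (induced_edges E S)"
    using dense_balanced_subgraph[of V D n p] finV V0 sides big \<open>p \<ge> 2\<close> by (auto simp: D_def)
  \<comment> \<open>All host edges inside \<open>S\<close> are taken, of every color, so that
    \<open>F\<close> is a full copy and not just its part of color \<open>a\<close>.\<close>
  define F where "F = induced_edges K S"
  have iso: "graph_iso (S, F) (complete_bipartite p p)"
    using induced_complete_bipartite_iso S unfolding F_def K_def V_def by blast
  have simp: "simple_graph (S, F)"
    using simple_graph_complete_bipartite[of n n]
    by (auto simp: simple_graph_def F_def K_def induced_edges_def)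
  then have "subgraph (S, F) (complete_bipartite n n)"
    using S by (auto simp: subgraph_def F_def K_def V_def induced_edges_def)
  then have "p^2 - 2*p + 2 \<le> card (c ` F)"
    using col iso by (auto simp: Hq_coloring_def)
  moreover have "card (c ` F) \<le> p^2 - 2*p + 1"
  proof -
    have finF: "finite F"
      using finK by (auto simp: F_def induced_edges_def)
    have cardF: "card F = p^2"
      using graph_iso_card_edges[OF simp simple_graph_complete_bipartite iso]
      by (simp add: card_edges_complete_bipartite power2_eq_square)
    have sub: "induced_edges E S \<subseteq> F"
      by (auto simp: F_def induced_edges_def E_def)
    \<comment> \<open>The edges of \<open>E\<close> inside \<open>S\<close> contribute only the
      color \<open>a\<close>, and each of the at most \<open>p^2 - 2*p\<close> others contributes at
      most one more.\<close>
    have "c ` F \<subseteq> insert a (c ` (F - induced_edges E S))"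
      by (auto simp: F_def induced_edges_def E_def)
    then have "card (c ` F) \<le> card (insert a (c ` (F - induced_edges E S)))"
      using finF by (intro card_mono) auto
    also have "\<dots> \<le> Suc (card (c ` (F - induced_edges E S)))"
      using finF by (simp add: card_insert_if)
    also have "\<dots> \<le> Suc (card (F - induced_edges E S))"
      using finF by (simp add: card_image_le)
    also have "card (F - induced_edges E S) = p^2 - card (induced_edges E S)"
      using sub finF cardF by (simp add: card_Diff_subset finite_subset)
    finally show ?thesis
      using S(4) by simp
  qed
  ultimately show False
    by simp
qed

section \<open>From the color bound to the asymptotic estimate\<close>

text \<open>With \<open>r\<close> the \<open>p\<close>-th root of \<open>n\<close>, the color bound
  gives \<open>D - p \<le> r\<close>. Combining \<open>D + 1 \<le> (p + 2) * r\<close> with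
  \<open>n \<le> 2 * k * (D + 1)\<close> and dividing by \<open>r\<close> yields the
  constant.\<close>

lemma gen_ramsey_lower_bound:
  assumes "p \<ge> 2" "n > 0"
  shows "real n powr (1 - 1 / real p)
    \<le> 2 * (real p + 2) *
        real (gen_ramsey (complete_bipartite n n) (complete_bipartite p p) (p^2 - 2*p + 2))"
proof -
  let ?K = "complete_bipartite n n" and ?H = "complete_bipartite p p" and ?q = "p^2 - 2*p + 2"
  define k where "k = gen_ramsey ?K ?H ?q"
  have "finite (edges ?K)"
    using card_edges_complete_bipartite[of n n] \<open>n > 0\<close>
    by (metis card_gt_0_iff nat_0_less_mult_iff)
  moreover have "?q \<le> card (edges ?H)"
  proof -
    have "2 * p \<le> p^2"
      using \<open>p \<ge> 2\<close> by (simp add: power2_eq_square)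
    moreover have "card (edges ?H) = p^2"
      by (simp add: card_edges_complete_bipartite power2_eq_square)
    ultimately show ?thesis
      using \<open>p \<ge> 2\<close> by linarith
  qed
  ultimately have "\<exists>k c. c ` edges ?K \<subseteq> {..<k} \<and> Hq_coloring ?K ?H ?q c"
    by (intro Hq_coloring_exists simple_graph_complete_bipartite)
  \<comment> \<open>The rainbow coloring makes the least palette size well defined, so
    \<open>k\<close> itself is attained by a coloring.\<close>
  then have "\<exists>c. c ` edges ?K \<subseteq> {..<k} \<and> Hq_coloring ?K ?H ?q c"
    unfolding k_def gen_ramsey_def by (rule LeastI_ex)
  then obtain c where c: "c ` edges ?K \<subseteq> {..<k}" "Hq_coloring ?K ?H ?q c"
    by blast
  have "k > 0"
  proof (rule ccontr)
    assume "\<not> k > 0"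
    then have "edges ?K = {}"
      using c(1) by simp
    with \<open>n > 0\<close> show False
      using card_edges_complete_bipartite[of n n] by simp
  qed
  define D where "D = n div (2 * k)"
  define r where "r = real n powr (1 / real p)"
  have "real ((D - p) ^ p) \<le> real n"
    using Hq_coloring_color_bound[OF c assms] unfolding D_def by (simp only: of_nat_le_iff)
  then have "real (D - p) ^ p \<le> r ^ p"
    using assms by (simp add: r_def powr_power)
  then have "real (D - p) \<le> r"
    using assms by (subst (asm) power_mono_iff) (auto simp: r_def)
  moreover have "1 \<le> r"
    using assms by (simp add: r_def ge_one_powr_ge_zero)
  \<comment> \<open>As \<open>1 \<le> r\<close>, the additive terms \<open>p\<close> and
    \<open>1\<close> are absorbed into multiples of \<open>r\<close>.\<close>
  ultimately have "real D + 1 \<le> (real p + 2) * r"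
  proof -
    have "real D \<le> real (D - p) + real p"
      by linarith
    moreover have "real p \<le> real p * r"
      using \<open>1 \<le> r\<close> by (simp add: mult_le_cancel_left1)
    ultimately show ?thesis
      using \<open>real (D - p) \<le> r\<close> \<open>1 \<le> r\<close> by (simp add: algebra_simps)
  qed
  moreover have "real n \<le> (2 * real k) * (real D + 1)"
  proof -
    \<comment> \<open>The \<open>+ 1\<close> compensates for the rounding in
      \<open>D\<close>.\<close>
    have "n < 2 * k * (D + 1)"
      unfolding D_def using \<open>k > 0\<close> dividend_less_times_div[of "2 * k" n] by simp
    then have "real n < real (2 * k * (D + 1))"
      by (simp only: of_nat_less_iff)
    then show ?thesis by (simp add: algebra_simps)
  qed
  ultimately have "real n \<le> (2 * real k) * ((real p + 2) * r)"
    by (meson mult_left_mono of_nat_0_le_iff order.trans zero_le_mult_iff zero_le_numeral)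
  moreover have "real n powr (1 - 1 / real p) = real n / r"
    using assms by (simp add: r_def powr_diff)
  ultimately show ?thesis
    using \<open>1 \<le> r\<close> unfolding k_def[symmetric] by (simp add: pos_divide_le_eq mult_ac)
qed

theorem theorem1p11:
  fixes p :: nat
  assumes "p \<ge> 2"
  shows "(\<lambda>n::nat. real (gen_ramsey (complete_bipartite n n) (complete_bipartite p p)
            (p^2 - 2*p + 2)))
         \<in> \<Omega>(\<lambda>n. real n powr (1 - 1 / real p))"
proof (rule landau_omega.bigI)
  show "0 < 1 / (2 * (real p + 2))"
    by simp
  show "\<forall>\<^sub>F n in at_top. 1 / (2 * (real p + 2)) * norm (real n powr (1 - 1 / real p))
      \<le> norm (real (gen_ramsey (complete_bipartite n n) (complete_bipartite p p) (p^2 - 2*p + 2)))"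
    using eventually_gt_at_top[of 0]
  proof eventually_elim
    case (elim n)
    then show ?case
      using gen_ramsey_lower_bound[OF assms, of n] by (simp add: field_simps)
  qed
qed

end
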